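(* For $r\in\mathbb R$ let $A_r(a,b)=\bigl(\frac{a^r+b^r}{2}\bigr)^{1/r}$ if $r\neq 0$ and $A_0(a,b)=\sqrt{ab}$, for $a,b>0$. For all $r$ with $-2\le r\le2$ and all $a,b>0$, $$a^{\frac{b}{a+b}}b^{\frac{a}{a+b}}\le A_{-2}(a,b)\le A_r(a,b)\le A_2(a,b)\le a^{\frac{a}{a+b}}b^{\frac{b}{a+b}},$$ where the constants $-2$ and $2$ are best possible: $r=2$ is the largest real $r$ such that $A_r(a,b)\le a^{\frac{a}{a+b}}b^{\frac{b}{a+b}}$ for all $a,b>0$, and $r=-2$ is the smallest real $r$ such that $a^{\frac{b}{a+b}}b^{\frac{a}{a+b}}\le A_r(a,b)$ for all $a,b>0$. Moreover, $(a,b)\mapsto a^{\frac{b}{a+b}}b^{\frac{a}{a+b}}$ is a left cancelling mean and $(a,b)\mapsto a^{\frac{a}{a+b}}b^{\frac{b}{a+b}}$ is a right cancelling mean for the class of Hölder means $\{A_r\}_{r\in\mathbb R}$.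
   Context: A mean is a map $M:\mathbb R_+\times\mathbb R_+\to\mathbb R_+$ (with $\mathbb R_+=(0,\infty)$) such that $\min(a,b)\le M(a,b)\le\max(a,b)$ for all $a,b>0$. $\Omega$ is the class of means that are symmetric, reflexive ($M(a,a)=a$) and homogeneous of order one. For means, $M\le N$ means $M(a,b)\le N(a,b)$ for all $a,b>0$; a family $\Delta$ of means is ordered if for any $M,N\in\Delta$ one has $M\le N$ or $N\le M$. Let $\Delta\subset\Omega$ be an ordered class of means. A mean $S^*$ is a right cancelling mean for $\Delta$ if there exists $M\in\Delta$ with $S^*\ge M$, but there is no $N\in\Delta$ such that $N(a,b)\ge S^*(a,b)$ for all $a,b>0$. A mean $S_*$ is a left cancelling mean for $\Delta$ if there exists $M\in\Delta$ with $S_*\le M$, but there is no $N\in\Delta$ such that $N(a,b)\le S_*(a,b)$ for all $a,b>0$. The Hölder means $A_r$ belong to $\Omega$ and are monotone increasing in $r\in\mathbb R$, so $\{A_r\}$ is ordered. *)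

theory Defs
  imports Complex_Main
begin

text \<open>
  A map on pairs of positive reals is represented by a total function
  of type \<^typ>\<open>real \<Rightarrow> real \<Rightarrow> real\<close>; only its values at positive arguments are
  ever constrained or compared.
\<close>

definition is_mean :: "(real \<Rightarrow> real \<Rightarrow> real) \<Rightarrow> bool" where
  "is_mean M \<longleftrightarrow> (\<forall>a>0. \<forall>b>0. min a b \<le> M a b \<and> M a b \<le> max a b)"

definition mean_le :: "(real \<Rightarrow> real \<Rightarrow> real) \<Rightarrow> (real \<Rightarrow> real \<Rightarrow> real) \<Rightarrow> bool" where
  "mean_le M N \<longleftrightarrow> (\<forall>a>0. \<forall>b>0. M a b \<le> N a b)"

definition Omega :: "(real \<Rightarrow> real \<Rightarrow> real) set" where
  "Omega = {M. is_mean M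
     \<and> (\<forall>a>0. \<forall>b>0. M a b = M b a)
     \<and> (\<forall>a>0. M a a = a)
     \<and> (\<forall>t>0. \<forall>a>0. \<forall>b>0. M (t * a) (t * b) = t * M a b)}"

definition ordered_means :: "(real \<Rightarrow> real \<Rightarrow> real) set \<Rightarrow> bool" where
  "ordered_means \<Delta> \<longleftrightarrow> (\<forall>M\<in>\<Delta>. \<forall>N\<in>\<Delta>. mean_le M N \<or> mean_le N M)"

text \<open>
  The standing assumption that \<open>\<Delta>\<close> is an ordered subclass of \<^const>\<open>Omega\<close> is part
  of both of the following definitions.
\<close>

definition right_cancelling_mean ::
  "(real \<Rightarrow> real \<Rightarrow> real) set \<Rightarrow> (real \<Rightarrow> real \<Rightarrow> real) \<Rightarrow> bool" where
  "right_cancelling_mean \<Delta> S \<longleftrightarrow>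
     \<Delta> \<subseteq> Omega \<and> ordered_means \<Delta> \<and> is_mean S
     \<and> (\<exists>M\<in>\<Delta>. mean_le M S) \<and> \<not> (\<exists>N\<in>\<Delta>. mean_le S N)"

definition left_cancelling_mean ::
  "(real \<Rightarrow> real \<Rightarrow> real) set \<Rightarrow> (real \<Rightarrow> real \<Rightarrow> real) \<Rightarrow> bool" where
  "left_cancelling_mean \<Delta> S \<longleftrightarrow>
     \<Delta> \<subseteq> Omega \<and> ordered_means \<Delta> \<and> is_mean S
     \<and> (\<exists>M\<in>\<Delta>. mean_le S M) \<and> \<not> (\<exists>N\<in>\<Delta>. mean_le N S)"

definition hoelder_mean :: "real \<Rightarrow> real \<Rightarrow> real \<Rightarrow> real" where
  "hoelder_mean r a b =
     (if r = 0 then sqrt (a * b) else ((a powr r + b powr r) / 2) powr (1 / r))"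

end

theory Submission
  imports Defs "HOL-Real_Asymp.Real_Asymp"
begin

text \<open>
  Write \<open>a = g e\<^sup>t\<close> and \<open>b = g e\<^sup>-\<^sup>t\<close> with \<open>g\<close> the geometric mean. Then \<open>A\<^sub>r = g exp (\<Lambda> r t)\<close>
  with \<open>\<Lambda> r t = ln (cosh (r t)) / r\<close>, and the two extreme means are \<open>g exp (\<plusminus> t tanh t)\<close>.
  Since \<open>\<Lambda>\<close> is odd in \<open>r\<close>, the lower half of every claim mirrors the upper half. The
  bound \<open>\<Lambda> 2 t \<le> t tanh t\<close> follows by differentiation from \<open>tanh (2 t) \<le> 2 t\<close>; comparing
  second-order terms at \<open>t = 0\<close> shows that 2 is optimal, and at \<open>t = \<infinity>\<close> the gap
  \<open>t tanh t - \<Lambda> r t\<close> tends to \<open>ln 2 / r > 0\<close>, so no \<open>A\<^sub>r\<close> dominates.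
\<close>

definition self_weighted_mean :: "real \<Rightarrow> real \<Rightarrow> real" where
  "self_weighted_mean a b = a powr (a / (a + b)) * b powr (b / (a + b))"

definition cross_weighted_mean :: "real \<Rightarrow> real \<Rightarrow> real" where
  "cross_weighted_mean a b = a powr (b / (a + b)) * b powr (a / (a + b))"

text \<open>The logarithm of a Hoelder mean after division by the geometric mean. The value 0 at
  \<open>r = 0\<close> is the limit for r tending to 0 and belongs to the geometric mean
  itself.\<close>

definition log_hoelder :: "real \<Rightarrow> real \<Rightarrow> real" where
  "log_hoelder r t = (if r = 0 then 0 else ln (cosh (r * t)) / r)"

section \<open>The means in balanced coordinates\<close>

lemma positive_pair_balanced:
  fixes a b :: real
  assumes "a > 0" "b > 0"
  obtains g t where "g > 0" "a = g * exp t" "b = g * exp (- t)"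
proof
  show "exp ((ln a + ln b) / 2) > 0" by simp
  show "a = exp ((ln a + ln b) / 2) * exp ((ln a - ln b) / 2)"
    using assms by (simp add: exp_add [symmetric] field_simps)
  show "b = exp ((ln a + ln b) / 2) * exp (- ((ln a - ln b) / 2))"
    using assms by (simp add: exp_add [symmetric] field_simps)
qed

lemma mean_le_balanced:
  "mean_le M N \<longleftrightarrow>
     (\<forall>g>0. \<forall>t. M (g * exp t) (g * exp (- t)) \<le> N (g * exp t) (g * exp (- t)))"
  unfolding mean_le_def by (metis positive_pair_balanced exp_gt_zero mult_pos_pos)

text \<open>The minimum and maximum of the pair are g exp(-|t|) and g exp(|t|), so betweenness is a
  bound on the exponent alone.\<close>

lemma is_mean_balanced:
  assumes "\<And>g t. g > 0 \<Longrightarrow> M (g * exp t) (g * exp (- t)) = g * exp (f t)"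
    and "\<And>t. \<bar>f t\<bar> \<le> \<bar>t\<bar>"
  shows "is_mean M"
  unfolding is_mean_def
proof (intro allI impI)
  fix a b :: real assume "a > 0" "b > 0"
  then obtain g t where *: "g > 0" "a = g * exp t" "b = g * exp (- t)"
    by (rule positive_pair_balanced)
  show "min a b \<le> M a b \<and> M a b \<le> max a b"
    using assms(1)[OF *(1), of t] assms(2)[of t] * by (auto simp: min_def max_def)
qed

lemma hoelder_mean_balanced:
  assumes "g > 0"
  shows "hoelder_mean r (g * exp t) (g * exp (- t)) = g * exp (log_hoelder r t)"
proof (cases "r = 0")
  case True
  have "g * exp t * (g * exp (- t)) = g ^ 2"
    by (simp add: exp_minus power2_eq_square)
  then show ?thesis using True assms by (simp add: hoelder_mean_def log_hoelder_def)
next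
  case False
  have "((g * exp t) powr r + (g * exp (- t)) powr r) / 2 = g powr r * cosh (r * t)"
    using assms by (simp add: powr_mult exp_powr_real cosh_def algebra_simps)
  moreover have "(g powr r * cosh (r * t)) powr (1 / r) = g * exp (log_hoelder r t)"
    using assms False
    by (simp add: powr_mult powr_powr log_hoelder_def powr_def [of "cosh _"])
  ultimately show ?thesis using False by (simp add: hoelder_mean_def)
qed

lemma weight_balanced:
  fixes g t :: real
  assumes "g > 0"
  shows "g * exp t / (g * exp t + g * exp (- t)) = (1 + tanh t) / 2"
    and "g * exp (- t) / (g * exp t + g * exp (- t)) = (1 - tanh t) / 2"
proof -
  have "g * exp t + g * exp (- t) = 2 * g * cosh t"
    by (simp add: cosh_def field_simps)
  moreover have "exp t = cosh t + sinh t" "exp (- t) = cosh t - sinh t"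
    by (simp_all add: cosh_plus_sinh cosh_minus_sinh)
  ultimately show "g * exp t / (g * exp t + g * exp (- t)) = (1 + tanh t) / 2"
    and "g * exp (- t) / (g * exp t + g * exp (- t)) = (1 - tanh t) / 2"
    using assms by (simp_all add: tanh_def add_divide_distrib diff_divide_distrib)
qed

text \<open>The logarithm of the mean averages ln g + t and ln g - t with weights (1 + tanh t)/2 and
  (1 - tanh t)/2. The weights add up to 1 and differ by tanh t.\<close>

lemma self_weighted_mean_balanced:
  assumes "g > 0"
  shows "self_weighted_mean (g * exp t) (g * exp (- t)) = g * exp (t * tanh t)"
proof -
  have "self_weighted_mean (g * exp t) (g * exp (- t))
      = exp (((1 + tanh t) / 2) * (ln g + t) + ((1 - tanh t) / 2) * (ln g - t))"
    unfolding self_weighted_mean_def weight_balanced [OF assms]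
    using assms by (simp add: powr_def ln_mult exp_add)
  also have "\<dots> = exp (ln g + t * tanh t)" by (simp add: field_simps)
  finally show ?thesis using assms by (simp add: exp_add)
qed

lemma cross_weighted_mean_balanced:
  assumes "g > 0"
  shows "cross_weighted_mean (g * exp t) (g * exp (- t)) = g * exp (- (t * tanh t))"
proof -
  have "cross_weighted_mean (g * exp t) (g * exp (- t))
      = exp (((1 - tanh t) / 2) * (ln g + t) + ((1 + tanh t) / 2) * (ln g - t))"
    unfolding cross_weighted_mean_def weight_balanced [OF assms]
    using assms by (simp add: powr_def ln_mult exp_add)
  also have "\<dots> = exp (ln g + - (t * tanh t))" by (simp add: field_simps)
  finally show ?thesis using assms unfolding exp_add by simp
qed

section \<open>Symmetry, monotonicity and size of the exponent\<close>

lemma log_hoelder_uminus: "log_hoelder (- r) t = - log_hoelder r t"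
  by (simp add: log_hoelder_def)

lemma log_hoelder_abs: "log_hoelder r \<bar>t\<bar> = log_hoelder r t"
  by (simp add: log_hoelder_def abs_if)

lemma log_hoelder_nonneg: "r \<ge> 0 \<Longrightarrow> log_hoelder r t \<ge> 0"
  using cosh_real_ge_1 [of "r * t"] by (simp add: log_hoelder_def)

lemma has_real_derivative_ln_cosh [derivative_intros]:
  fixes f :: "real \<Rightarrow> real"
  assumes "(f has_real_derivative f') (at x within A)"
  shows "((\<lambda>x. ln (cosh (f x))) has_real_derivative tanh (f x) * f') (at x within A)"
  by (rule derivative_eq_intros assms refl | simp add: cosh_real_pos tanh_def)+

text \<open>An instance of convexity: ln cosh vanishes at 0 and its derivative tanh is increasing.
  With c = r/s it gives monotonicity of \<open>log_hoelder\<close> in the parameter.\<close>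

lemma ln_cosh_scale_le:
  assumes "0 \<le> c" "c \<le> 1" "0 \<le> x"
  shows "ln (cosh (c * x)) \<le> c * ln (cosh (x::real))"
proof -
  have "(\<lambda>x. c * ln (cosh x) - ln (cosh (c * x))) 0 \<le> (\<lambda>x. c * ln (cosh x) - ln (cosh (c * x))) x"
  proof (rule DERIV_nonneg_imp_nondecreasing [OF assms(3)])
    fix y :: real assume "0 \<le> y" "y \<le> x"
    then have "c * y \<le> y" using assms by (simp add: mult_left_le_one_le)
    then have "c * (tanh y - tanh (c * y)) \<ge> 0" using assms by simp
    moreover have "((\<lambda>x. c * ln (cosh x) - ln (cosh (c * x))) has_real_derivative
        c * (tanh y - tanh (c * y))) (at y)"
      by (rule derivative_eq_intros refl)+ (simp add: algebra_simps)
    ultimately show "\<exists>d. ((\<lambda>x. c * ln (cosh x) - ln (cosh (c * x))) has_real_derivative d) (at y) \<and> d \<ge> 0"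
      by blast
  qed
  then show ?thesis by simp
qed

lemma log_hoelder_mono:
  assumes "r \<le> s"
  shows "log_hoelder r t \<le> log_hoelder s t"
proof -
  have pos: "log_hoelder r t \<le> log_hoelder s t" if "0 \<le> r" "r \<le> s" for r s
  proof (cases "r = 0")
    case True
    then show ?thesis using log_hoelder_nonneg [of s t] that by (simp add: log_hoelder_def)
  next
    case False
    with that have "ln (cosh ((r / s) * (s * \<bar>t\<bar>))) \<le> (r / s) * ln (cosh (s * \<bar>t\<bar>))"
      by (intro ln_cosh_scale_le) auto
    then have "log_hoelder r \<bar>t\<bar> \<le> log_hoelder s \<bar>t\<bar>"
      using False that by (simp add: log_hoelder_def field_simps)
    then show ?thesis by (simp add: log_hoelder_abs)
  qed
  consider "0 \<le> r" | "r \<le> 0" "0 \<le> s" | "s \<le> 0" by linarith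
  then show ?thesis
  proof cases
    case 1
    then show ?thesis using pos assms by simp
  next
    \<comment> \<open>For parameters of opposite sign, 0 separates the two exponents.\<close>
    case 2
    then show ?thesis
      using log_hoelder_nonneg [of s t] log_hoelder_nonneg [of "- r" t]
      by (simp add: log_hoelder_uminus)
  next
    case 3
    then show ?thesis
      using pos [of "- s" "- r"] assms by (simp add: log_hoelder_uminus)
  qed
qed

text \<open>This rests on 1 \<le> cosh x \<le> exp |x| at x = r t.\<close>

lemma abs_log_hoelder_le: "\<bar>log_hoelder r t\<bar> \<le> \<bar>t\<bar>"
proof (cases "r = 0")
  case True
  then show ?thesis by (simp add: log_hoelder_def)
next
  case False
  have "cosh (r * t) \<le> exp \<bar>r * t\<bar>"
    by (cases "r * t \<ge> 0") (auto simp: cosh_def)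
  then have "ln (cosh (r * t)) \<le> \<bar>r * t\<bar>"
    by (metis cosh_real_pos ln_exp ln_le_cancel_iff exp_gt_zero)
  moreover have "0 \<le> ln (cosh (r * t))"
    by (simp add: cosh_real_ge_1)
  ultimately show ?thesis
    using False by (simp add: log_hoelder_def abs_mult field_simps)
qed

section \<open>The sharp constant 2 and the behaviour at infinity\<close>

lemma tanh_real_le_self:
  assumes "0 \<le> x"
  shows "tanh x \<le> (x::real)"
proof -
  have "(\<lambda>x. x - tanh x) 0 \<le> (\<lambda>x. x - tanh x) x"
  proof (rule DERIV_nonneg_imp_nondecreasing [OF assms])
    fix y :: real
    have "((\<lambda>x. x - tanh x) has_real_derivative (tanh y)\<^sup>2) (at y)"
      by (rule derivative_eq_intros refl | simp)+
    then show "\<exists>d. ((\<lambda>x. x - tanh x) has_real_derivative d) (at y) \<and> d \<ge> 0"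
      by (meson zero_le_power2)
  qed
  then show ?thesis by simp
qed

lemma tanh_double: "tanh (2 * x) = 2 * tanh x / (1 + (tanh (x::real))\<^sup>2)"
  using tanh_add [of x x] by (simp add: power2_eq_square)

lemma log_hoelder_two_le: "log_hoelder 2 t \<le> t * tanh t"
proof -
  \<comment> \<open>Both sides are even in t and \<open>f 0 = 0\<close>, so it suffices that f is
    nondecreasing on [0, |t|].\<close>
  define f where "f x = x * tanh x - ln (cosh (2 * x)) / 2" for x :: real
  have "f 0 \<le> f \<bar>t\<bar>"
  proof (rule DERIV_nonneg_imp_nondecreasing [OF abs_ge_zero])
    fix y :: real assume y: "0 \<le> y"
    define u where "u = tanh y"
    have "1 + u\<^sup>2 > 0" by (simp add: add_pos_nonneg)
    have "u\<^sup>2 < 1"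
      unfolding u_def using tanh_real_bounds [of y] by (simp add: abs_square_less_1 abs_less_iff)
    have "2 * u / (1 + u\<^sup>2) \<le> 2 * y"
      using tanh_real_le_self [of "2 * y"] y by (simp add: tanh_double u_def)
    then have "(1 - u\<^sup>2) * (y - u / (1 + u\<^sup>2)) \<ge> 0"
      using \<open>u\<^sup>2 < 1\<close> by simp
    \<comment> \<open>The right-hand side is the derivative of f. Its second factor on the left is y
      - tanh(2y)/2 by the double-angle formula, hence nonnegative.\<close>
    moreover have "(1 - u\<^sup>2) * (y - u / (1 + u\<^sup>2)) = u + y * (1 - u\<^sup>2) - 2 * u / (1 + u\<^sup>2)"
      using \<open>1 + u\<^sup>2 > 0\<close> by (simp add: divide_simps) algebra
    moreover have "(f has_real_derivative u + y * (1 - u\<^sup>2) - 2 * u / (1 + u\<^sup>2)) (at y)"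
    proof -
      have "((\<lambda>x. x * tanh x) has_real_derivative u + y * (1 - u\<^sup>2)) (at y)"
        by (rule derivative_eq_intros refl | simp add: u_def)+
      moreover have "((\<lambda>x. ln (cosh (2 * x))) has_real_derivative tanh (2 * y) * 2) (at y)"
        by (rule has_real_derivative_ln_cosh) (auto intro!: derivative_eq_intros)
      ultimately have "(f has_real_derivative u + y * (1 - u\<^sup>2) - tanh (2 * y) * 2 / 2) (at y)"
        unfolding f_def by (intro DERIV_diff DERIV_cdivide)
      then have "(f has_real_derivative u + y * (1 - u\<^sup>2) - tanh (2 * y)) (at y)" by simp
      then show ?thesis by (simp only: tanh_double u_def)
    qed
    ultimately show "\<exists>d. (f has_real_derivative d) (at y) \<and> d \<ge> 0"
      by metis
  qed
  then have "log_hoelder 2 \<bar>t\<bar> \<le> \<bar>t\<bar> * tanh \<bar>t\<bar>"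
    by (simp add: f_def log_hoelder_def)
  moreover have "\<bar>t\<bar> * tanh \<bar>t\<bar> = t * tanh t" by (cases "t \<ge> 0") auto
  ultimately show ?thesis by (simp add: log_hoelder_abs)
qed

lemma log_hoelder_bound_imp_le_two:
  assumes "\<And>t. log_hoelder r t \<le> t * tanh t"
  shows "r \<le> 2"
proof (rule ccontr)
  assume r: "\<not> r \<le> 2"
  \<comment> \<open>Near 0, ln(cosh(r t))/r behaves like r t^2/2 and t tanh t like t^2; the
    assumption r > 2 fixes the sign of r.\<close>
  then have "((\<lambda>t. ln (cosh (r * t)) / r / t\<^sup>2) \<longlongrightarrow> r / 2) (at_right 0)"
    by real_asymp
  moreover have "((\<lambda>t. t * tanh t / t\<^sup>2) \<longlongrightarrow> 1) (at_right (0::real))"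
    by real_asymp
  moreover have "\<forall>\<^sub>F t in at_right 0. ln (cosh (r * t)) / r / t\<^sup>2 \<le> t * tanh t / t\<^sup>2"
    using assms r by (intro always_eventually allI divide_right_mono) (auto simp: log_hoelder_def)
  ultimately have "r / 2 \<le> 1"
    by (intro tendsto_le [of "at_right 0"]) auto
  with r show False by simp
qed

lemma log_hoelder_not_dominating: "\<exists>t. log_hoelder r t < t * tanh t"
proof -
  \<comment> \<open>Raising the parameter to a positive s only strengthens the claim, by
    monotonicity.\<close>
  define s where "s = max r 1"
  have "s > 0" by (simp add: s_def)
  \<comment> \<open>The limit equals ln 2 / s, since ln(cosh(s t)) = s t - ln 2 + o(1) and t tanh t
    = t + o(1).\<close>
  then have "((\<lambda>t. t * tanh t - ln (cosh (s * t)) / s) \<longlongrightarrow> - (ln (1 / 2) * inverse s)) at_top"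
    by real_asymp
  then have "\<forall>\<^sub>F t in at_top. 0 < t * tanh t - ln (cosh (s * t)) / s"
    by (rule order_tendstoD) (simp add: \<open>s > 0\<close> ln_div)
  then obtain t where "log_hoelder s t < t * tanh t"
    using \<open>s > 0\<close> by (auto simp: log_hoelder_def dest: eventually_happens)
  moreover have "log_hoelder r t \<le> log_hoelder s t"
    by (rule log_hoelder_mono) (simp add: s_def)
  ultimately show ?thesis by (meson le_less_trans)
qed

section \<open>Membership in the classes of means\<close>

lemma hoelder_mean_in_Omega: "hoelder_mean r \<in> Omega"
proof -
  have "is_mean (hoelder_mean r)"
    by (rule is_mean_balanced [OF hoelder_mean_balanced abs_log_hoelder_le])
  moreover have "hoelder_mean r a b = hoelder_mean r b a" for a b
    by (simp add: hoelder_mean_def ac_simps)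
  moreover have "hoelder_mean r a a = a" if "a > 0" for a
    using hoelder_mean_balanced [OF that, of r 0] by (simp add: log_hoelder_def)
  moreover have "hoelder_mean r (c * a) (c * b) = c * hoelder_mean r a b"
    if "c > 0" "a > 0" "b > 0" for a b c
  proof -
    \<comment> \<open>Scaling the pair by c replaces g by c g and leaves t unchanged.\<close>
    from \<open>a > 0\<close> \<open>b > 0\<close> obtain g t where "g > 0" "a = g * exp t" "b = g * exp (- t)"
      by (rule positive_pair_balanced)
    then show ?thesis
      using hoelder_mean_balanced [of g r t] hoelder_mean_balanced [of "c * g" r t] that
      by (simp add: mult.assoc)
  qed
  ultimately show ?thesis unfolding Omega_def by blast
qed

lemma mean_le_hoelder_mean: "r \<le> s \<Longrightarrow> mean_le (hoelder_mean r) (hoelder_mean s)"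
  by (simp add: mean_le_balanced hoelder_mean_balanced log_hoelder_mono)

lemma ordered_means_hoelder: "ordered_means (range hoelder_mean)"
  unfolding ordered_means_def using mean_le_hoelder_mean by (metis imageE linear)

lemma abs_mult_tanh_le: "\<bar>t * tanh t\<bar> \<le> \<bar>t::real\<bar>"
  using tanh_real_bounds [of t] by (simp add: abs_mult mult_left_le abs_le_iff less_imp_le)

lemma is_mean_self_weighted_mean: "is_mean self_weighted_mean"
  by (rule is_mean_balanced [OF self_weighted_mean_balanced abs_mult_tanh_le])

lemma is_mean_cross_weighted_mean: "is_mean cross_weighted_mean"
  by (rule is_mean_balanced [OF cross_weighted_mean_balanced]) (simp_all add: abs_mult_tanh_le)

section \<open>Comparisons and cancelling means\<close>

lemma hoelder_mean_le_self_weighted_iff: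
  "mean_le (hoelder_mean r) self_weighted_mean \<longleftrightarrow> (\<forall>t. log_hoelder r t \<le> t * tanh t)"
  \<comment> \<open>The common factor g cancels; 1 serves as a positive value of g.\<close>
  by (auto simp: mean_le_balanced hoelder_mean_balanced self_weighted_mean_balanced
      intro: exI [of _ 1])

lemma self_weighted_le_hoelder_mean_iff:
  "mean_le self_weighted_mean (hoelder_mean r) \<longleftrightarrow> (\<forall>t. t * tanh t \<le> log_hoelder r t)"
  by (auto simp: mean_le_balanced hoelder_mean_balanced self_weighted_mean_balanced
      intro: exI [of _ 1])

text \<open>Negating r negates the Hoelder exponent, and the two weighted means have opposite
  exponents, so a change of sign reverses the comparison.\<close>

lemma cross_weighted_le_hoelder_mean_iff:
  "mean_le cross_weighted_mean (hoelder_mean r) \<longleftrightarrow>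
     mean_le (hoelder_mean (- r)) self_weighted_mean"
  by (auto simp: mean_le_balanced hoelder_mean_balanced self_weighted_mean_balanced
      cross_weighted_mean_balanced log_hoelder_uminus minus_le_iff intro: exI [of _ 1])

lemma hoelder_mean_le_cross_weighted_iff:
  "mean_le (hoelder_mean r) cross_weighted_mean \<longleftrightarrow>
     mean_le self_weighted_mean (hoelder_mean (- r))"
  by (auto simp: mean_le_balanced hoelder_mean_balanced self_weighted_mean_balanced
      cross_weighted_mean_balanced log_hoelder_uminus le_minus_iff intro: exI [of _ 1])

text \<open>One equivalence holds both the upper bound and the optimality of 2: sufficiency reduces
  to r = 2 by monotonicity, necessity comes from t near 0.\<close>

lemma hoelder_mean_le_self_weighted: "mean_le (hoelder_mean r) self_weighted_mean \<longleftrightarrow> r \<le> 2"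
proof
  assume "mean_le (hoelder_mean r) self_weighted_mean"
  then show "r \<le> 2"
    by (intro log_hoelder_bound_imp_le_two) (simp add: hoelder_mean_le_self_weighted_iff)
next
  assume "r \<le> 2"
  then show "mean_le (hoelder_mean r) self_weighted_mean"
    by (meson hoelder_mean_le_self_weighted_iff log_hoelder_mono log_hoelder_two_le order_trans)
qed

lemma cross_weighted_le_hoelder_mean: "mean_le cross_weighted_mean (hoelder_mean r) \<longleftrightarrow> -2 \<le> r"
  by (auto simp: cross_weighted_le_hoelder_mean_iff hoelder_mean_le_self_weighted)

lemma not_self_weighted_le_hoelder_mean: "\<not> mean_le self_weighted_mean (hoelder_mean r)"
  using log_hoelder_not_dominating [of r] by (auto simp: self_weighted_le_hoelder_mean_iff not_le)

lemma right_cancelling_self_weighted: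
  "right_cancelling_mean (range hoelder_mean) self_weighted_mean"
  unfolding right_cancelling_mean_def
  using hoelder_mean_in_Omega ordered_means_hoelder is_mean_self_weighted_mean
    hoelder_mean_le_self_weighted not_self_weighted_le_hoelder_mean by blast

lemma left_cancelling_cross_weighted:
  "left_cancelling_mean (range hoelder_mean) cross_weighted_mean"
  unfolding left_cancelling_mean_def
  using hoelder_mean_in_Omega ordered_means_hoelder is_mean_cross_weighted_mean
    cross_weighted_le_hoelder_mean hoelder_mean_le_cross_weighted_iff
    not_self_weighted_le_hoelder_mean by blast

theorem theorem2p2:
  shows "(\<forall>r a b :: real. -2 \<le> r \<longrightarrow> r \<le> 2 \<longrightarrow> 0 < a \<longrightarrow> 0 < b \<longrightarrow>
            a powr (b / (a + b)) * b powr (a / (a + b)) \<le> hoelder_mean (-2) a b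
          \<and> hoelder_mean (-2) a b \<le> hoelder_mean r a b
          \<and> hoelder_mean r a b \<le> hoelder_mean 2 a b
          \<and> hoelder_mean 2 a b \<le> a powr (a / (a + b)) * b powr (b / (a + b)))
       \<and> (\<forall>a>0. \<forall>b>0. hoelder_mean 2 a b \<le> a powr (a / (a + b)) * b powr (b / (a + b)))
       \<and> (\<forall>r. (\<forall>a>0. \<forall>b>0. hoelder_mean r a b \<le> a powr (a / (a + b)) * b powr (b / (a + b)))
              \<longrightarrow> r \<le> 2)
       \<and> (\<forall>a>0. \<forall>b>0. a powr (b / (a + b)) * b powr (a / (a + b)) \<le> hoelder_mean (-2) a b)
       \<and> (\<forall>r. (\<forall>a>0. \<forall>b>0. a powr (b / (a + b)) * b powr (a / (a + b)) \<le> hoelder_mean r a b)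
              \<longrightarrow> -2 \<le> r)
       \<and> left_cancelling_mean (range hoelder_mean)
           (\<lambda>a b. a powr (b / (a + b)) * b powr (a / (a + b)))
       \<and> right_cancelling_mean (range hoelder_mean)
           (\<lambda>a b. a powr (a / (a + b)) * b powr (b / (a + b)))"
proof -
  note self = hoelder_mean_le_self_weighted [unfolded mean_le_def self_weighted_mean_def]
  note cross = cross_weighted_le_hoelder_mean [unfolded mean_le_def cross_weighted_mean_def]
  note mono = mean_le_hoelder_mean [unfolded mean_le_def, rule_format]
  have "self_weighted_mean = (\<lambda>a b. a powr (a / (a + b)) * b powr (b / (a + b)))"
    "cross_weighted_mean = (\<lambda>a b. a powr (b / (a + b)) * b powr (a / (a + b)))"
    by (simp_all add: fun_eq_iff self_weighted_mean_def cross_weighted_mean_def)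
  note canc = left_cancelling_cross_weighted [unfolded this]
    right_cancelling_self_weighted [unfolded this]
  show ?thesis
    \<comment> \<open>Each bound quantified over all pairs becomes a condition on r, which makes the
      optimality claims immediate.\<close>
    unfolding self cross
    using self [of 2] cross [of "-2"] mono canc by auto
qed

end
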